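(* Let $S$ be a semidomain. Then the following statements are equivalent: (1) $S$ is an integrally closed semidomain. (2) $S_T$ is an integrally closed semidomain for any multiplicatively closed set $T$ of $S$. (3) $S_{\mathfrak{m}}$ is an integrally closed semidomain for any maximal ideal $\mathfrak{m}$ of $S$.
   Context: A semiring is a nonempty set $S$ with two operations $+$ and $\cdot$ such that $(S,+)$ is a commutative monoid with identity $0$, $(S,\cdot)$ is a commutative monoid with identity $1\neq 0$, multiplication distributes over addition, and $s\cdot 0=0$ for all $s\in S$. A semidomain is a semiring $S$ such that $ab=ac$ implies $b=c$ for all $b,c\in S$ and all nonzero $a\in S$. An ideal of $S$ is a nonempty subset $I$ with $a+b\in I$ and $sa\in I$ for all $a,b\in I$, $s\in S$; a maximal ideal is an ideal maximal among the ideals different from $S$ (it is automatically prime). A multiplicatively closed set of $S$ is a nonempty subset $T\subseteq S$ with $1\in T$ and $w_1w_2\in T$ for all $w_1,w_2\in T$. The localization $S_T$ of $S$ at $T$ is defined as in ring theory: it consists of the fractions $a/t$ ($a\in S$, $t\in T$), where $a/t=b/t'$ iff $wat'=wbt$ for some $w\in T$, with the usual addition and multiplication of fractions; $S_{\mathfrak m}$ denotes the localization at $S-\mathfrak{m}$. The semifield of fractions $F(S)$ of a semidomain $S$ is the localization of $S$ at $S-\{0\}$, and $S$ is regarded as a subsemiring of $F(S)$. An element $u\in F(S)$ is integral over $S$ if there exist $n\ge 1$ and $a_1,\ldots,a_n,b_1,\ldots,b_n\in S$ such that $u^n+a_1u^{n-1}+\cdots+a_n=b_1u^{n-1}+\cdots+b_n$.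 A semidomain $S$ is integrally closed if every element of $F(S)$ integral over $S$ belongs to $S$.
   Formalization: In (2) the multiplicatively closed set T is required not to contain 0; if 0 is in T (for example T = S), then S_T has 1 = 0 and is not a semidomain, so (2) as written would fail for every S. *)

theory Defs
  imports "HOL-Algebra.Ring"
begin

locale semidomain = semiring S + comm_monoid S for S (structure) +
  assumes one_not_zero: "\<one> \<noteq> \<zero>"
    and mult_cancel: "\<lbrakk> a \<in> carrier S; b \<in> carrier S; c \<in> carrier S; a \<noteq> \<zero>; a \<otimes> b = a \<otimes> c \<rbrakk>
                        \<Longrightarrow> b = c"

text \<open>The locale \<open>ideal\<close> of HOL-Algebra extends \<open>ring\<close>, so it is not available over a semiring.\<close>

locale semiring_ideal = semiring S for I and S (structure) +
  assumes ideal_subset: "I \<subseteq> carrier S"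
    and ideal_nonempty: "I \<noteq> {}"
    and ideal_add_closed: "\<lbrakk> a \<in> I; b \<in> I \<rbrakk> \<Longrightarrow> a \<oplus> b \<in> I"
    and ideal_mult_closed: "\<lbrakk> a \<in> I; s \<in> carrier S \<rbrakk> \<Longrightarrow> s \<otimes> a \<in> I"

locale maximal_semiring_ideal = semiring_ideal I S for I and S (structure) +
  assumes ideal_proper: "I \<noteq> carrier S"
    and ideal_maximal: "\<lbrakk> semiring_ideal J S; I \<subseteq> J; J \<noteq> carrier S \<rbrakk> \<Longrightarrow> J = I"

text \<open>A fraction \<open>a/t\<close> is the class of the pair \<open>(a, t)\<close>. A multiplicatively closed set is a
  \<open>submonoid\<close> of the multiplicative monoid.\<close>

definition fraction_rel :: "('a, 'm) ring_scheme \<Rightarrow> 'a set \<Rightarrow> (('a \<times> 'a) \<times> ('a \<times> 'a)) set" where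
  "fraction_rel S T =
     {((a, t), (b, t')). a \<in> carrier S \<and> b \<in> carrier S \<and> t \<in> T \<and> t' \<in> T \<and>
        (\<exists>w\<in>T. w \<otimes>\<^bsub>S\<^esub> a \<otimes>\<^bsub>S\<^esub> t' = w \<otimes>\<^bsub>S\<^esub> b \<otimes>\<^bsub>S\<^esub> t)}"

definition fraction :: "('a, 'm) ring_scheme \<Rightarrow> 'a set \<Rightarrow> 'a \<Rightarrow> 'a \<Rightarrow> ('a \<times> 'a) set" where
  "fraction S T a t = fraction_rel S T `` {(a, t)}"

text \<open>The union over all representatives of the two classes is the usual way of lifting an
  operation to a quotient: all the united classes coincide.\<close>

definition localization :: "('a, 'm) ring_scheme \<Rightarrow> 'a set \<Rightarrow> ('a \<times> 'a) set ring" where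
  "localization S T =
     \<lparr> carrier = (carrier S \<times> T) // fraction_rel S T,
       mult = (\<lambda>X Y. \<Union>(a, t)\<in>X. \<Union>(b, t')\<in>Y. fraction S T (a \<otimes>\<^bsub>S\<^esub> b) (t \<otimes>\<^bsub>S\<^esub> t')),
       one = fraction S T \<one>\<^bsub>S\<^esub> \<one>\<^bsub>S\<^esub>,
       zero = fraction S T \<zero>\<^bsub>S\<^esub> \<one>\<^bsub>S\<^esub>,
       add = (\<lambda>X Y. \<Union>(a, t)\<in>X. \<Union>(b, t')\<in>Y.
                fraction S T (a \<otimes>\<^bsub>S\<^esub> t' \<oplus>\<^bsub>S\<^esub> b \<otimes>\<^bsub>S\<^esub> t) (t \<otimes>\<^bsub>S\<^esub> t')) \<rparr>"

definition semifield_of_fractions :: "('a, 'm) ring_scheme \<Rightarrow> ('a \<times> 'a) set ring" where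
  "semifield_of_fractions S = localization S (carrier S - {\<zero>\<^bsub>S\<^esub>})"

text \<open>The canonical map \<open>s \<mapsto> s/1\<close>, along which \<open>S\<close> is regarded as a subsemiring of its semifield
  of fractions.\<close>

definition to_fractions :: "('a, 'm) ring_scheme \<Rightarrow> 'a \<Rightarrow> ('a \<times> 'a) set" where
  "to_fractions S s = fraction S (carrier S - {\<zero>\<^bsub>S\<^esub>}) s \<one>\<^bsub>S\<^esub>"

definition integral_over :: "('a, 'm) ring_scheme \<Rightarrow> ('a \<times> 'a) set \<Rightarrow> bool" where
  "integral_over S u \<longleftrightarrow>
     (let F = semifield_of_fractions S in
      \<exists>n::nat. n \<ge> 1 \<and> (\<exists>a \<in> {1..n} \<rightarrow> carrier S. \<exists>b \<in> {1..n} \<rightarrow> carrier S.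
        u [^]\<^bsub>F\<^esub> n \<oplus>\<^bsub>F\<^esub> (\<Oplus>\<^bsub>F\<^esub>i\<in>{1..n}. to_fractions S (a i) \<otimes>\<^bsub>F\<^esub> u [^]\<^bsub>F\<^esub> (n - i)) =
        (\<Oplus>\<^bsub>F\<^esub>i\<in>{1..n}. to_fractions S (b i) \<otimes>\<^bsub>F\<^esub> u [^]\<^bsub>F\<^esub> (n - i))))"

locale integrally_closed_semidomain = semidomain S for S (structure) +
  assumes integrally_closed:
    "\<lbrakk> u \<in> carrier (semifield_of_fractions S); integral_over S u \<rbrakk>
       \<Longrightarrow> u \<in> to_fractions S ` carrier S"

end

theory Submission
  imports Defs
begin

text \<open>Clearing denominators turns the integrality of a fraction \<open>x/y\<close> into a homogeneous equation
  between \<open>x\<close> and \<open>y\<close> in \<open>S\<close> itself, so that \<open>S\<close> is integrally closed iff this equation forces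
  \<open>y\<close> to divide \<open>x\<close>. If \<open>x/y\<close> is integral over \<open>S\<^sub>T\<close> and \<open>v \<in> T\<close> is a common denominator of the
  coefficients, then \<open>v x/y\<close> is integral over \<open>S\<close>. Conversely, a fraction integral over \<open>S\<close> is
  integral over every \<open>S\<^sub>\<mm>\<close>, so if all these are integrally closed, its ideal of denominators
  lies in no maximal ideal.\<close>

section \<open>Semidomains and their localizations\<close>

context semidomain
begin

lemma mult_left_cancel:
  "\<lbrakk> a \<in> carrier S; a \<noteq> \<zero>; b \<in> carrier S; c \<in> carrier S \<rbrakk> \<Longrightarrow> a \<otimes> b = a \<otimes> c \<longleftrightarrow> b = c"
  using mult_cancel by blast

lemma integral:
  assumes "a \<in> carrier S" "b \<in> carrier S" "a \<noteq> \<zero>" "b \<noteq> \<zero>"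
  shows "a \<otimes> b \<noteq> \<zero>"
  using mult_left_cancel[of a b \<zero>] assms by auto

lemma pow_nonzero:
  "\<lbrakk> a \<in> carrier S; a \<noteq> \<zero> \<rbrakk> \<Longrightarrow> a [^] (n::nat) \<noteq> \<zero>"
  by (induction n) (auto simp: one_not_zero integral)

text \<open>Makes the semifield of fractions an instance of localization, so that the results about
  \<open>T\<close> below apply to it as well.\<close>

lemma submonoid_nonzero: "submonoid (carrier S - {\<zero>}) S"
  by unfold_locales (auto simp: one_not_zero integral)

end

text \<open>Excluding 0 keeps all denominators cancellable. With 0 in \<open>T\<close>, the choice
  \<open>w = \<zero>\<close> would identify all fractions, giving 1 = 0 in the localization.\<close>

locale semidomain_denominators = semidomain S for S (structure) and T +
  assumes submonoid: "submonoid T S"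
    and zero_notin: "\<zero> \<notin> T"
begin

lemma T_carrier [simp]: "t \<in> T \<Longrightarrow> t \<in> carrier S"
  using submonoid submonoid.subset by fastforce

lemma T_one [simp]: "\<one> \<in> T"
  using submonoid by (rule submonoid.one_closed)

lemma T_mult [simp]: "\<lbrakk> t \<in> T; u \<in> T \<rbrakk> \<Longrightarrow> t \<otimes> u \<in> T"
  using submonoid by (rule submonoid.m_closed)

lemma T_cancel:
  "\<lbrakk> t \<in> T; a \<in> carrier S; b \<in> carrier S \<rbrakk> \<Longrightarrow> t \<otimes> a = t \<otimes> b \<longleftrightarrow> a = b"
  using mult_left_cancel zero_notin T_carrier by metis

text \<open>The factor \<open>w\<close> in the definition is nonzero and cancels; conversely
  \<open>w = \<one>\<close> will do. Equality of fractions becomes plain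
  cross-multiplication.\<close>

lemma fraction_rel_iff:
  "((a, t), (b, u)) \<in> fraction_rel S T \<longleftrightarrow>
     a \<in> carrier S \<and> b \<in> carrier S \<and> t \<in> T \<and> u \<in> T \<and> a \<otimes> u = b \<otimes> t"
  unfolding fraction_rel_def using T_cancel T_one by (auto simp: m_assoc)

lemma fraction_rel_trans:
  assumes "((a, t), (b, u)) \<in> fraction_rel S T" "((b, u), (c, v)) \<in> fraction_rel S T"
  shows "((a, t), (c, v)) \<in> fraction_rel S T"
proof -
  have C: "a \<in> carrier S" "b \<in> carrier S" "c \<in> carrier S" "t \<in> T" "u \<in> T" "v \<in> T"
    and eq: "a \<otimes> u = b \<otimes> t" "b \<otimes> v = c \<otimes> u"
    using assms by (auto simp: fraction_rel_iff)
  \<comment> \<open>The two cross-multiplied equations combine only after multiplication by the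
    middle denominator \<open>u\<close>, which is cancelled at the end.\<close>
  have "u \<otimes> (a \<otimes> v) = (a \<otimes> u) \<otimes> v" using C by (simp add: m_ac)
  also have "\<dots> = (b \<otimes> v) \<otimes> t" using C by (simp add: eq(1) m_ac)
  also have "\<dots> = u \<otimes> (c \<otimes> t)" using C by (simp add: eq(2) m_ac)
  finally show ?thesis using C T_cancel by (simp add: fraction_rel_iff)
qed

lemma equiv_fraction_rel: "equiv (carrier S \<times> T) (fraction_rel S T)"
proof (rule equivI)
  show "fraction_rel S T \<subseteq> (carrier S \<times> T) \<times> (carrier S \<times> T)"
    by (auto simp: fraction_rel_iff)
  show "refl_on (carrier S \<times> T) (fraction_rel S T)"
    by (auto simp: refl_on_def fraction_rel_iff)
  show "sym (fraction_rel S T)"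
    by (auto simp: sym_def fraction_rel_iff)
  show "trans (fraction_rel S T)"
    using fraction_rel_trans by (auto simp: trans_def)
qed

lemma mem_fraction_iff:
  "(b, u) \<in> fraction S T a t \<longleftrightarrow>
     a \<in> carrier S \<and> b \<in> carrier S \<and> t \<in> T \<and> u \<in> T \<and> a \<otimes> u = b \<otimes> t"
  by (simp add: fraction_def fraction_rel_iff)

lemma fraction_eq_iff:
  assumes "a \<in> carrier S" "b \<in> carrier S" "t \<in> T" "u \<in> T"
  shows "fraction S T a t = fraction S T b u \<longleftrightarrow> a \<otimes> u = b \<otimes> t"
  using assms eq_equiv_class_iff[OF equiv_fraction_rel, of "(a, t)" "(b, u)"]
  by (simp add: fraction_def fraction_rel_iff)

text \<open>Collapses the unions by which \<open>localization\<close> lifts its operations: the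
  united sets coincide, and there is at least one because the class contains
  \<open>(a, t)\<close>.\<close>

lemma UN_fraction:
  assumes "a \<in> carrier S" "t \<in> T"
    and "\<And>b u. (b, u) \<in> fraction S T a t \<Longrightarrow> f b u = X"
  shows "(\<Union>(b, u)\<in>fraction S T a t. f b u) = X"
proof -
  have "(a, t) \<in> fraction S T a t" using assms by (simp add: mem_fraction_iff)
  then show ?thesis using assms(3) by fast
qed

section \<open>Operations on fractions\<close>

abbreviation L where "L \<equiv> localization S T"

lemma fraction_mult:
  assumes "a \<in> carrier S" "b \<in> carrier S" "t \<in> T" "u \<in> T"
  shows "fraction S T a t \<otimes>\<^bsub>L\<^esub> fraction S T b u = fraction S T (a \<otimes> b) (t \<otimes> u)"
proof -
  \<comment> \<open>Independence of the representatives; applying \<open>UN_fraction\<close> to both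
    unions then leaves a single fraction.\<close>
  have "fraction S T (a' \<otimes> b') (t' \<otimes> u') = fraction S T (a \<otimes> b) (t \<otimes> u)"
    if "(a', t') \<in> fraction S T a t" "(b', u') \<in> fraction S T b u" for a' b' t' u'
  proof -
    have C: "a' \<in> carrier S" "b' \<in> carrier S" "t' \<in> T" "u' \<in> T"
      and eq: "a \<otimes> t' = a' \<otimes> t" "b \<otimes> u' = b' \<otimes> u"
      using that by (auto simp: mem_fraction_iff)
    have "(a' \<otimes> b') \<otimes> (t \<otimes> u) = (a' \<otimes> t) \<otimes> (b' \<otimes> u)" using C assms by (simp add: m_ac)
    also have "\<dots> = (a \<otimes> t') \<otimes> (b \<otimes> u')" by (simp add: eq)
    also have "\<dots> = (a \<otimes> b) \<otimes> (t' \<otimes> u')" using C assms by (simp add: m_ac)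
    finally show ?thesis using C assms by (simp add: fraction_eq_iff)
  qed
  then show ?thesis
    using assms by (simp add: localization_def UN_fraction)
qed

lemma fraction_add:
  assumes "a \<in> carrier S" "b \<in> carrier S" "t \<in> T" "u \<in> T"
  shows "fraction S T a t \<oplus>\<^bsub>L\<^esub> fraction S T b u = fraction S T (a \<otimes> u \<oplus> b \<otimes> t) (t \<otimes> u)"
proof -
  have "fraction S T (a' \<otimes> u' \<oplus> b' \<otimes> t') (t' \<otimes> u') = fraction S T (a \<otimes> u \<oplus> b \<otimes> t) (t \<otimes> u)"
    if "(a', t') \<in> fraction S T a t" "(b', u') \<in> fraction S T b u" for a' b' t' u'
  proof -
    have C: "a' \<in> carrier S" "b' \<in> carrier S" "t' \<in> T" "u' \<in> T"
      and eq: "a \<otimes> t' = a' \<otimes> t" "b \<otimes> u' = b' \<otimes> u"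
      using that by (auto simp: mem_fraction_iff)
    have "(a' \<otimes> u' \<oplus> b' \<otimes> t') \<otimes> (t \<otimes> u) = (a' \<otimes> t) \<otimes> (u' \<otimes> u) \<oplus> (b' \<otimes> u) \<otimes> (t' \<otimes> t)"
      using C assms by (simp add: l_distr r_distr m_ac)
    also have "\<dots> = (a \<otimes> t') \<otimes> (u' \<otimes> u) \<oplus> (b \<otimes> u') \<otimes> (t' \<otimes> t)" by (simp add: eq)
    also have "\<dots> = (a \<otimes> u \<oplus> b \<otimes> t) \<otimes> (t' \<otimes> u')" using C assms by (simp add: l_distr r_distr m_ac)
    finally show ?thesis using C assms by (simp add: fraction_eq_iff)
  qed
  then show ?thesis
    using assms by (simp add: localization_def UN_fraction)
qed

lemma fraction_closed:
  "\<lbrakk> a \<in> carrier S; t \<in> T \<rbrakk> \<Longrightarrow> fraction S T a t \<in> carrier L"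
  by (auto simp: localization_def fraction_def intro: quotientI)

lemma localization_cases:
  assumes "X \<in> carrier L"
  obtains a t where "a \<in> carrier S" "t \<in> T" "X = fraction S T a t"
  using assms by (auto simp: localization_def fraction_def elim!: quotientE)

lemma localization_zero: "\<zero>\<^bsub>L\<^esub> = fraction S T \<zero> \<one>"
  and localization_one: "\<one>\<^bsub>L\<^esub> = fraction S T \<one> \<one>"
  by (simp_all add: localization_def)

lemma fraction_eq_zero_iff:
  "\<lbrakk> a \<in> carrier S; t \<in> T \<rbrakk> \<Longrightarrow> fraction S T a t = \<zero>\<^bsub>L\<^esub> \<longleftrightarrow> a = \<zero>"
  by (simp add: localization_zero fraction_eq_iff)

text \<open>These rules reduce a law for fractions to a cross-multiplied identity in
  \<open>S\<close>, which distributivity and commutativity settle.\<close>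

lemmas fraction_simps =
  fraction_mult fraction_add fraction_closed localization_zero localization_one fraction_eq_iff

section \<open>The semidomain laws for fractions\<close>

lemma semiring_localization: "semiring L"
proof (rule semiring.intro)
  show "abelian_monoid L"
  proof (rule abelian_monoidI)
    fix X Y Z assume "X \<in> carrier L" "Y \<in> carrier L" "Z \<in> carrier L"
    then show "X \<oplus>\<^bsub>L\<^esub> Y \<oplus>\<^bsub>L\<^esub> Z = X \<oplus>\<^bsub>L\<^esub> (Y \<oplus>\<^bsub>L\<^esub> Z)"
      by (elim localization_cases) (simp add: fraction_simps l_distr r_distr m_ac a_ac)
  next
    fix X Y assume "X \<in> carrier L" "Y \<in> carrier L"
    then show "X \<oplus>\<^bsub>L\<^esub> Y \<in> carrier L" "X \<oplus>\<^bsub>L\<^esub> Y = Y \<oplus>\<^bsub>L\<^esub> X"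
      by (elim localization_cases; simp add: fraction_simps m_ac a_ac)+
  next
    fix X assume "X \<in> carrier L"
    then show "\<zero>\<^bsub>L\<^esub> \<oplus>\<^bsub>L\<^esub> X = X"
      by (elim localization_cases) (simp add: fraction_simps)
  qed (simp add: fraction_simps)
  show "Group.monoid L"
  proof (rule monoidI)
    fix X Y Z assume "X \<in> carrier L" "Y \<in> carrier L" "Z \<in> carrier L"
    then show "X \<otimes>\<^bsub>L\<^esub> Y \<otimes>\<^bsub>L\<^esub> Z = X \<otimes>\<^bsub>L\<^esub> (Y \<otimes>\<^bsub>L\<^esub> Z)"
      by (elim localization_cases) (simp add: fraction_simps m_ac)
  next
    fix X Y assume "X \<in> carrier L" "Y \<in> carrier L"
    then show "X \<otimes>\<^bsub>L\<^esub> Y \<in> carrier L"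
      by (elim localization_cases; simp add: fraction_simps)
  next
    fix X assume "X \<in> carrier L"
    then show "\<one>\<^bsub>L\<^esub> \<otimes>\<^bsub>L\<^esub> X = X" "X \<otimes>\<^bsub>L\<^esub> \<one>\<^bsub>L\<^esub> = X"
      by (elim localization_cases; simp add: fraction_simps)+
  qed (simp add: fraction_simps)
  show "semiring_axioms L"
  proof
    fix X Y Z assume "X \<in> carrier L" "Y \<in> carrier L" "Z \<in> carrier L"
    then show "(X \<oplus>\<^bsub>L\<^esub> Y) \<otimes>\<^bsub>L\<^esub> Z = X \<otimes>\<^bsub>L\<^esub> Z \<oplus>\<^bsub>L\<^esub> Y \<otimes>\<^bsub>L\<^esub> Z"
      "Z \<otimes>\<^bsub>L\<^esub> (X \<oplus>\<^bsub>L\<^esub> Y) = Z \<otimes>\<^bsub>L\<^esub> X \<oplus>\<^bsub>L\<^esub> Z \<otimes>\<^bsub>L\<^esub> Y"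
      by (elim localization_cases; simp add: fraction_simps l_distr r_distr m_ac a_ac)+
  next
    fix X assume "X \<in> carrier L"
    then show "\<zero>\<^bsub>L\<^esub> \<otimes>\<^bsub>L\<^esub> X = \<zero>\<^bsub>L\<^esub>" "X \<otimes>\<^bsub>L\<^esub> \<zero>\<^bsub>L\<^esub> = \<zero>\<^bsub>L\<^esub>"
      by (elim localization_cases; simp add: fraction_simps)+
  qed
qed

lemma semidomain_localization: "semidomain L"
proof (rule semidomain.intro)
  show "semiring L" by (rule semiring_localization)
  then interpret L: semiring L .
  show "comm_monoid L"
  proof (rule L.monoid_comm_monoidI)
    fix X Y assume "X \<in> carrier L" "Y \<in> carrier L"
    then show "X \<otimes>\<^bsub>L\<^esub> Y = Y \<otimes>\<^bsub>L\<^esub> X"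
      by (elim localization_cases) (simp add: fraction_simps m_ac)
  qed
  show "semidomain_axioms L"
  proof
    show "\<one>\<^bsub>L\<^esub> \<noteq> \<zero>\<^bsub>L\<^esub>"
      using one_not_zero by (simp add: fraction_eq_zero_iff localization_one)
    fix X Y Z
    assume "X \<in> carrier L" "Y \<in> carrier L" "Z \<in> carrier L" "X \<noteq> \<zero>\<^bsub>L\<^esub>"
      and eq: "X \<otimes>\<^bsub>L\<^esub> Y = X \<otimes>\<^bsub>L\<^esub> Z"
    then obtain a t b u c v where C: "a \<in> carrier S" "t \<in> T" "b \<in> carrier S" "u \<in> T"
      "c \<in> carrier S" "v \<in> T"
      and X: "X = fraction S T a t" "Y = fraction S T b u" "Z = fraction S T c v"
      and "a \<noteq> \<zero>"
      by (metis localization_cases fraction_eq_zero_iff)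
    \<comment> \<open>Cross-multiplying \<open>eq\<close> leaves the common factors \<open>t\<close>
      and \<open>a\<close>. Both are nonzero, and cancelling them yields the criterion for
      \<open>b/u = c/v\<close>.\<close>
    have "t \<otimes> (a \<otimes> (b \<otimes> v)) = (a \<otimes> b) \<otimes> (t \<otimes> v)" using C by (simp add: m_ac)
    also have "\<dots> = (a \<otimes> c) \<otimes> (t \<otimes> u)" using eq C by (simp add: X fraction_simps)
    also have "\<dots> = t \<otimes> (a \<otimes> (c \<otimes> u))" using C by (simp add: m_ac)
    finally show "Y = Z"
      using C \<open>a \<noteq> \<zero>\<close> by (simp add: X fraction_eq_iff T_cancel mult_left_cancel)
  qed
qed

end

lemma (in semidomain) denominatorsI:
  "\<lbrakk> submonoid T S; \<zero> \<notin> T \<rbrakk> \<Longrightarrow> semidomain_denominators S T"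
  using semidomain_axioms
  by (simp add: semidomain_denominators_def semidomain_denominators_axioms_def)

section \<open>Integral equations with cleared denominators\<close>

text \<open>The lower-order part of an integral equation, homogenized to degree \<open>n\<close> by
  a second variable \<open>y\<close>. Setting \<open>y = \<one>\<close> recovers the usual sum; the
  leading term \<open>x [^] n\<close> is left out because \<open>i\<close> starts at 1.\<close>

definition homogeneous_form ::
  "('a, 'm) ring_scheme \<Rightarrow> nat \<Rightarrow> (nat \<Rightarrow> 'a) \<Rightarrow> 'a \<Rightarrow> 'a \<Rightarrow> 'a" where
  "homogeneous_form S n a x y =
     (\<Oplus>\<^bsub>S\<^esub>i\<in>{1..n}. a i \<otimes>\<^bsub>S\<^esub> (x [^]\<^bsub>S\<^esub> (n - i) \<otimes>\<^bsub>S\<^esub> y [^]\<^bsub>S\<^esub> i))"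

text \<open>The equation expressing that \<open>x/y\<close> is integral, multiplied by \<open>y\<^sup>n\<close>.\<close>

definition integral_eq ::
  "('a, 'm) ring_scheme \<Rightarrow> nat \<Rightarrow> (nat \<Rightarrow> 'a) \<Rightarrow> (nat \<Rightarrow> 'a) \<Rightarrow> 'a \<Rightarrow> 'a \<Rightarrow> bool" where
  "integral_eq S n a b x y \<longleftrightarrow>
     x [^]\<^bsub>S\<^esub> n \<oplus>\<^bsub>S\<^esub> homogeneous_form S n a x y = homogeneous_form S n b x y"

text \<open>For nonzero \<open>y\<close> this is integrality of \<open>x/y\<close>, phrased without
  fractions so that it makes sense in \<open>S\<close> and in its localizations alike.\<close>

definition integral_pair :: "('a, 'm) ring_scheme \<Rightarrow> 'a \<Rightarrow> 'a \<Rightarrow> bool" where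
  "integral_pair S x y \<longleftrightarrow>
     (\<exists>n::nat. n \<ge> 1 \<and> (\<exists>a \<in> {1..n} \<rightarrow> carrier S. \<exists>b \<in> {1..n} \<rightarrow> carrier S. integral_eq S n a b x y))"

section \<open>Integral equations under scaling\<close>

context semidomain
begin

lemma homogeneous_form_closed [simp]:
  "\<lbrakk> a \<in> {1..n} \<rightarrow> carrier S; x \<in> carrier S; y \<in> carrier S \<rbrakk> \<Longrightarrow>
     homogeneous_form S n a x y \<in> carrier S"
  unfolding homogeneous_form_def by (rule finsum_closed) auto

text \<open>Every monomial has total degree \<open>n\<close> in \<open>x\<close> and
  \<open>y\<close>.\<close>

lemma homogeneous_form_scale:
  assumes a: "a \<in> {1..n} \<rightarrow> carrier S" and C: "x \<in> carrier S" "y \<in> carrier S" "c \<in> carrier S"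
  shows "homogeneous_form S n a (c \<otimes> x) (c \<otimes> y) = c [^] n \<otimes> homogeneous_form S n a x y"
proof -
  have summand: "a i \<otimes> ((c \<otimes> x) [^] (n - i) \<otimes> (c \<otimes> y) [^] i) =
      c [^] n \<otimes> (a i \<otimes> (x [^] (n - i) \<otimes> y [^] i))" if i: "i \<in> {1..n}" for i
  proof -
    have "c [^] n = c [^] (n - i) \<otimes> c [^] i" using i C by (simp add: nat_pow_mult)
    moreover have "a i \<in> carrier S" using a i by auto
    ultimately show ?thesis using C by (simp add: nat_pow_distrib m_ac)
  qed
  show ?thesis
    unfolding homogeneous_form_def using a C
    by (subst finsum_rdistr) (auto intro!: finsum_cong simp: summand Pi_iff)
qed

text \<open>With only \<open>x\<close> scaled, its power supplies \<open>c [^] (n - i)\<close>; the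
  missing \<open>c [^] i\<close> is put into the coefficient.\<close>

lemma homogeneous_form_scale_left:
  assumes a: "a \<in> {1..n} \<rightarrow> carrier S" and C: "x \<in> carrier S" "y \<in> carrier S" "c \<in> carrier S"
  shows "homogeneous_form S n (\<lambda>i. c [^] i \<otimes> a i) (c \<otimes> x) y = c [^] n \<otimes> homogeneous_form S n a x y"
proof -
  have summand: "(c [^] i \<otimes> a i) \<otimes> ((c \<otimes> x) [^] (n - i) \<otimes> y [^] i) =
      c [^] n \<otimes> (a i \<otimes> (x [^] (n - i) \<otimes> y [^] i))" if i: "i \<in> {1..n}" for i
  proof -
    have "c [^] n = c [^] (n - i) \<otimes> c [^] i" using i C by (simp add: nat_pow_mult)
    moreover have "a i \<in> carrier S" using a i by auto
    ultimately show ?thesis using C by (simp add: nat_pow_distrib m_ac)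
  qed
  show ?thesis
    unfolding homogeneous_form_def using a C
    by (subst finsum_rdistr) (auto intro!: finsum_cong simp: summand Pi_iff)
qed

text \<open>Both sides acquire the factor \<open>c [^] n\<close>, which is nonzero and
  cancels.\<close>

lemma integral_eq_scale_iff:
  assumes "a \<in> {1..n} \<rightarrow> carrier S" "b \<in> {1..n} \<rightarrow> carrier S"
    and "x \<in> carrier S" "y \<in> carrier S" "c \<in> carrier S" "c \<noteq> \<zero>"
  shows "integral_eq S n a b (c \<otimes> x) (c \<otimes> y) \<longleftrightarrow> integral_eq S n a b x y"
  unfolding integral_eq_def using assms
  by (simp add: homogeneous_form_scale nat_pow_distrib flip: r_distr)
    (simp add: mult_left_cancel pow_nonzero)

text \<open>Allows a fraction to be expanded or reduced, in particular to trade entries from a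
  localization for entries from \<open>S\<close>.\<close>

lemma integral_pair_scale_iff:
  assumes "x \<in> carrier S" "y \<in> carrier S" "c \<in> carrier S" "c \<noteq> \<zero>"
  shows "integral_pair S (c \<otimes> x) (c \<otimes> y) \<longleftrightarrow> integral_pair S x y"
  unfolding integral_pair_def using integral_eq_scale_iff[OF _ _ assms] by blast

text \<open>The classical step from an equation for \<open>x/y\<close> to one for
  \<open>c x/y\<close>: when \<open>c\<close> is a common denominator of the coefficients, the new
  ones are free of denominators.\<close>

lemma integral_eq_scale_left:
  assumes "integral_eq S n a b x y"
    and "a \<in> {1..n} \<rightarrow> carrier S" "b \<in> {1..n} \<rightarrow> carrier S"
    and "x \<in> carrier S" "y \<in> carrier S" "c \<in> carrier S"
  shows "integral_eq S n (\<lambda>i. c [^] i \<otimes> a i) (\<lambda>i. c [^] i \<otimes> b i) (c \<otimes> x) y"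
  using assms unfolding integral_eq_def
  by (simp add: homogeneous_form_scale_left nat_pow_distrib flip: r_distr)

end

text \<open>Isolates what is used of the map \<open>s \<mapsto> s/1\<close>. Preservation of zero is
  listed separately: \<open>ring_hom\<close> does not contain it, and additivity alone does not give
  it in the absence of additive inverses.\<close>

locale semidomain_embedding = S: semidomain S + L: semidomain L for S (structure) and L (structure) +
  fixes \<phi>
  assumes hom: "\<phi> \<in> ring_hom S L"
    and hom_zero: "\<phi> \<zero>\<^bsub>S\<^esub> = \<zero>\<^bsub>L\<^esub>"
    and inj: "inj_on \<phi> (carrier S)"
begin

lemma hom_closed [simp]: "x \<in> carrier S \<Longrightarrow> \<phi> x \<in> carrier L"
  using hom by (rule ring_hom_closed)

lemma hom_mult: "\<lbrakk> x \<in> carrier S; y \<in> carrier S \<rbrakk> \<Longrightarrow> \<phi> (x \<otimes>\<^bsub>S\<^esub> y) = \<phi> x \<otimes>\<^bsub>L\<^esub> \<phi> y"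
  using hom by (rule ring_hom_mult)

lemma hom_add: "\<lbrakk> x \<in> carrier S; y \<in> carrier S \<rbrakk> \<Longrightarrow> \<phi> (x \<oplus>\<^bsub>S\<^esub> y) = \<phi> x \<oplus>\<^bsub>L\<^esub> \<phi> y"
  using hom by (rule ring_hom_add)

lemma hom_pow: "x \<in> carrier S \<Longrightarrow> \<phi> (x [^]\<^bsub>S\<^esub> (n::nat)) = \<phi> x [^]\<^bsub>L\<^esub> n"
  by (induction n) (auto simp: hom_mult ring_hom_one[OF hom])

lemma hom_eq_iff: "\<lbrakk> x \<in> carrier S; y \<in> carrier S \<rbrakk> \<Longrightarrow> \<phi> x = \<phi> y \<longleftrightarrow> x = y"
  using inj by (auto simp: inj_on_def)

lemma hom_eq_zero_iff: "x \<in> carrier S \<Longrightarrow> \<phi> x = \<zero>\<^bsub>L\<^esub> \<longleftrightarrow> x = \<zero>\<^bsub>S\<^esub>"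
  using hom_eq_iff[of x "\<zero>\<^bsub>S\<^esub>"] by (simp add: hom_zero)

lemma hom_finsum:
  "\<lbrakk> finite A; f \<in> A \<rightarrow> carrier S \<rbrakk> \<Longrightarrow> \<phi> (\<Oplus>\<^bsub>S\<^esub>i\<in>A. f i) = (\<Oplus>\<^bsub>L\<^esub>i\<in>A. \<phi> (f i))"
proof (induction A rule: finite_induct)
  case empty
  then show ?case by (simp add: hom_zero)
next
  case (insert i A)
  then show ?case by (simp add: hom_add Pi_iff)
qed

lemma hom_homogeneous_form:
  assumes "a \<in> {1..n} \<rightarrow> carrier S" "x \<in> carrier S" "y \<in> carrier S"
  shows "\<phi> (homogeneous_form S n a x y) = homogeneous_form L n (\<phi> \<circ> a) (\<phi> x) (\<phi> y)"
proof -
  have "\<phi> (homogeneous_form S n a x y) =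
      (\<Oplus>\<^bsub>L\<^esub>i\<in>{1..n}. \<phi> (a i \<otimes>\<^bsub>S\<^esub> (x [^]\<^bsub>S\<^esub> (n - i) \<otimes>\<^bsub>S\<^esub> y [^]\<^bsub>S\<^esub> i)))"
    unfolding homogeneous_form_def using assms by (intro hom_finsum) auto
  also have "\<dots> = homogeneous_form L n (\<phi> \<circ> a) (\<phi> x) (\<phi> y)"
    unfolding homogeneous_form_def
    by (rule L.finsum_cong) (use assms in \<open>auto simp: hom_mult hom_pow Pi_iff simp_implies_def\<close>)
  finally show ?thesis .
qed

text \<open>The two sides over \<open>L\<close> are the images of the two sides over
  \<open>S\<close>, so injectivity reflects the equation as well.\<close>

lemma integral_eq_hom_iff:
  assumes "a \<in> {1..n} \<rightarrow> carrier S" "b \<in> {1..n} \<rightarrow> carrier S" "x \<in> carrier S" "y \<in> carrier S"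
  shows "integral_eq L n (\<phi> \<circ> a) (\<phi> \<circ> b) (\<phi> x) (\<phi> y) \<longleftrightarrow> integral_eq S n a b x y"
  unfolding integral_eq_def using assms
  by (simp add: S.homogeneous_form_closed hom_eq_iff
      flip: hom_homogeneous_form hom_pow hom_add)

lemma integral_pair_hom:
  assumes "integral_pair S x y" "x \<in> carrier S" "y \<in> carrier S"
  shows "integral_pair L (\<phi> x) (\<phi> y)"
proof -
  obtain n :: nat and a b where "n \<ge> 1" and
    ab: "a \<in> {1..n} \<rightarrow> carrier S" "b \<in> {1..n} \<rightarrow> carrier S" "integral_eq S n a b x y"
    using assms(1) by (auto simp: integral_pair_def)
  moreover have "\<phi> \<circ> a \<in> {1..n} \<rightarrow> carrier L" "\<phi> \<circ> b \<in> {1..n} \<rightarrow> carrier L"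
    using ab by (simp_all add: Pi_iff)
  moreover have "integral_eq L n (\<phi> \<circ> a) (\<phi> \<circ> b) (\<phi> x) (\<phi> y)"
    using ab assms integral_eq_hom_iff by blast
  ultimately show ?thesis unfolding integral_pair_def by blast
qed

end

section \<open>Descent of integral equations from the localization\<close>

context semidomain_denominators
begin

definition embed where "embed a = fraction S T a \<one>"

sublocale embed: semidomain_embedding S L embed
proof -
  interpret L: semidomain L by (rule semidomain_localization)
  show "semidomain_embedding S L embed"
  proof
    show "embed \<in> ring_hom S L"
      by (rule ring_hom_memI) (simp_all add: embed_def fraction_simps)
    show "embed \<zero> = \<zero>\<^bsub>L\<^esub>"
      by (simp add: embed_def localization_zero)
    show "inj_on embed (carrier S)"
      by (rule inj_onI) (simp add: embed_def fraction_eq_iff)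
  qed
qed

lemma embed_mult_fraction:
  "\<lbrakk> a \<in> carrier S; t \<in> T \<rbrakk> \<Longrightarrow> embed t \<otimes>\<^bsub>L\<^esub> fraction S T a t = embed a"
  by (simp add: embed_def fraction_simps m_ac)

lemma embed_nonzero: "t \<in> T \<Longrightarrow> embed t \<noteq> \<zero>\<^bsub>L\<^esub>"
  using zero_notin by (auto simp: embed.hom_eq_zero_iff)

text \<open>Induction on the finite set, multiplying the denominators together one at a
  time.\<close>

lemma common_denominator:
  assumes "finite A" "f \<in> A \<rightarrow> carrier L"
  shows "\<exists>t\<in>T. \<exists>g. g \<in> A \<rightarrow> carrier S \<and> (\<forall>i\<in>A. embed t \<otimes>\<^bsub>L\<^esub> f i = embed (g i))"
  using assms
proof (induction A rule: finite_induct)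
  case empty
  show ?case using T_one by blast
next
  case (insert i A)
  then obtain t g where t: "t \<in> T" and g: "g \<in> A \<rightarrow> carrier S"
    and eq: "\<And>j. j \<in> A \<Longrightarrow> embed t \<otimes>\<^bsub>L\<^esub> f j = embed (g j)"
    by auto
  from insert.prems have "f i \<in> carrier L" by auto
  then obtain a u where a: "a \<in> carrier S" "u \<in> T" "f i = fraction S T a u"
    by (rule localization_cases)
  \<comment> \<open>For the denominator \<open>t \<otimes> u\<close> the old numerators gain the
    factor \<open>u\<close>, and the new numerator \<open>a\<close> gains \<open>t\<close>.\<close>
  define h where "h = (\<lambda>j. u \<otimes> g j)(i := t \<otimes> a)"
  have "h \<in> insert i A \<rightarrow> carrier S"
    using t g a by (auto simp: h_def Pi_iff)
  moreover have "embed (t \<otimes> u) \<otimes>\<^bsub>L\<^esub> f j = embed (h j)" if "j \<in> insert i A" for j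
  proof (cases "j = i")
    case True
    then show ?thesis
      using t a by (simp add: h_def embed.hom_mult embed.L.m_assoc fraction_closed embed_mult_fraction)
  next
    case False
    with that have j: "j \<in> A" by simp
    then have "f j \<in> carrier L" "g j \<in> carrier S" using insert.prems g by auto
    then have "embed (t \<otimes> u) \<otimes>\<^bsub>L\<^esub> f j = embed u \<otimes>\<^bsub>L\<^esub> (embed t \<otimes>\<^bsub>L\<^esub> f j)"
      using t a by (simp add: embed.hom_mult embed.L.m_ac)
    also have "\<dots> = embed (h j)"
      using t a False \<open>g j \<in> carrier S\<close> by (simp add: h_def embed.hom_mult eq[OF j])
    finally show ?thesis .
  qed
  ultimately show ?case using t a T_mult by blast
qed

text \<open>If \<open>v\<close> clears all coefficients, multiplying the equation by
  \<open>v [^] n\<close> gives one for \<open>v \<otimes> x\<close> whose coefficients,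
  \<open>v [^] i\<close> times the old ones, come from \<open>S\<close>.\<close>

lemma integral_pair_embedD:
  assumes "integral_pair L (embed x) (embed y)" "x \<in> carrier S" "y \<in> carrier S"
  obtains t where "t \<in> T" "integral_pair S (t \<otimes> x) y"
proof -
  note C = assms(2,3)
  obtain n :: nat and a b where "n \<ge> 1"
    and ab: "a \<in> {1..n} \<rightarrow> carrier L" "b \<in> {1..n} \<rightarrow> carrier L"
    and eq: "integral_eq L n a b (embed x) (embed y)"
    using assms(1) by (auto simp: integral_pair_def)
  obtain t a' where t: "t \<in> T" and a': "a' \<in> {1..n} \<rightarrow> carrier S"
    and ta: "\<And>i. i \<in> {1..n} \<Longrightarrow> embed t \<otimes>\<^bsub>L\<^esub> a i = embed (a' i)"
    using common_denominator[OF _ ab(1)] by auto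
  obtain u b' where u: "u \<in> T" and b': "b' \<in> {1..n} \<rightarrow> carrier S"
    and ub: "\<And>i. i \<in> {1..n} \<Longrightarrow> embed u \<otimes>\<^bsub>L\<^esub> b i = embed (b' i)"
    using common_denominator[OF _ ab(2)] by auto
  \<comment> \<open>One denominator for both families: \<open>t\<close> clears the
    \<open>a i\<close>, \<open>u\<close> clears the \<open>b i\<close>.\<close>
  define v where "v = t \<otimes> u"
  have v: "v \<in> T" using t u by (simp add: v_def)
  \<comment> \<open>As \<open>i \<ge> 1\<close>, one factor \<open>t \<otimes> u\<close> splits off
    \<open>v [^] i\<close>. Its \<open>t\<close> is absorbed in turning \<open>a i\<close> into
    \<open>a' i\<close>, and \<open>u\<close> remains; for \<open>b''\<close> the roles are
    exchanged.\<close>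
  define a'' where "a'' i = v [^] (i - 1) \<otimes> (u \<otimes> a' i)" for i
  define b'' where "b'' i = v [^] (i - 1) \<otimes> (t \<otimes> b' i)" for i
  have ab'': "a'' \<in> {1..n} \<rightarrow> carrier S" "b'' \<in> {1..n} \<rightarrow> carrier S"
    using t u v a' b' by (auto simp: a''_def b''_def Pi_iff)
  have coeff_a: "embed v [^]\<^bsub>L\<^esub> i \<otimes>\<^bsub>L\<^esub> a i = embed (a'' i)" if i: "i \<in> {1..n}" for i
  proof -
    have C': "a i \<in> carrier L" "a' i \<in> carrier S" using ab a' i by auto
    have "embed v [^]\<^bsub>L\<^esub> i = embed v [^]\<^bsub>L\<^esub> (i - 1) \<otimes>\<^bsub>L\<^esub> (embed u \<otimes>\<^bsub>L\<^esub> embed t)"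
      using i t u by (cases i) (auto simp: v_def embed.hom_mult embed.L.m_comm)
    then have "embed v [^]\<^bsub>L\<^esub> i \<otimes>\<^bsub>L\<^esub> a i =
        embed v [^]\<^bsub>L\<^esub> (i - 1) \<otimes>\<^bsub>L\<^esub> (embed u \<otimes>\<^bsub>L\<^esub> (embed t \<otimes>\<^bsub>L\<^esub> a i))"
      using C' t u v by (simp add: embed.L.m_assoc)
    then show ?thesis
      using C' t u v by (simp add: a''_def ta[OF i] embed.hom_mult embed.hom_pow)
  qed
  have coeff_b: "embed v [^]\<^bsub>L\<^esub> i \<otimes>\<^bsub>L\<^esub> b i = embed (b'' i)" if i: "i \<in> {1..n}" for i
  proof -
    have C': "b i \<in> carrier L" "b' i \<in> carrier S" using ab b' i by auto
    have "embed v [^]\<^bsub>L\<^esub> i = embed v [^]\<^bsub>L\<^esub> (i - 1) \<otimes>\<^bsub>L\<^esub> (embed t \<otimes>\<^bsub>L\<^esub> embed u)"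
      using i t u by (cases i) (auto simp: v_def embed.hom_mult)
    then have "embed v [^]\<^bsub>L\<^esub> i \<otimes>\<^bsub>L\<^esub> b i =
        embed v [^]\<^bsub>L\<^esub> (i - 1) \<otimes>\<^bsub>L\<^esub> (embed t \<otimes>\<^bsub>L\<^esub> (embed u \<otimes>\<^bsub>L\<^esub> b i))"
      using C' t u v by (simp add: embed.L.m_assoc)
    then show ?thesis
      using C' t u v by (simp add: b''_def ub[OF i] embed.hom_mult embed.hom_pow)
  qed
  \<comment> \<open>The coefficient functions agree only on \<open>{1..n}\<close>, so the sums are
    compared rather than the functions.\<close>
  have form: "homogeneous_form L n (\<lambda>i. embed v [^]\<^bsub>L\<^esub> i \<otimes>\<^bsub>L\<^esub> a i) X Y = homogeneous_form L n (embed \<circ> a'') X Y"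
    "homogeneous_form L n (\<lambda>i. embed v [^]\<^bsub>L\<^esub> i \<otimes>\<^bsub>L\<^esub> b i) X Y = homogeneous_form L n (embed \<circ> b'') X Y"
    if "X \<in> carrier L" "Y \<in> carrier L" for X Y
    unfolding homogeneous_form_def
    by (rule embed.L.finsum_cong; use that ab'' coeff_a coeff_b in \<open>auto simp: Pi_iff simp_implies_def\<close>)+
  have "integral_eq L n (\<lambda>i. embed v [^]\<^bsub>L\<^esub> i \<otimes>\<^bsub>L\<^esub> a i) (\<lambda>i. embed v [^]\<^bsub>L\<^esub> i \<otimes>\<^bsub>L\<^esub> b i)
      (embed v \<otimes>\<^bsub>L\<^esub> embed x) (embed y)"
    using embed.L.integral_eq_scale_left[OF eq ab, of "embed v"] v C by simp
  then have "integral_eq L n (embed \<circ> a'') (embed \<circ> b'') (embed (v \<otimes> x)) (embed y)"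
    using v C
    by (simp add: integral_eq_def embed.hom_mult form)
  then have "integral_eq S n a'' b'' (v \<otimes> x) y"
    using embed.integral_eq_hom_iff ab'' v C by simp
  then have "integral_pair S (v \<otimes> x) y"
    unfolding integral_pair_def using \<open>n \<ge> 1\<close> ab'' by blast
  with v show ?thesis by (rule that)
qed

end

section \<open>Integral closedness as a divisibility condition\<close>

context semidomain
begin

text \<open>The equation for \<open>u = x/y\<close> is the homogeneous one at \<open>(u, 1)\<close>.
  Scaling by \<open>y\<close> moves it to \<open>(x, y)\<close>, and the embedding reflects it into
  \<open>S\<close>.\<close>

lemma integral_over_fraction_iff:
  assumes C: "x \<in> carrier S" "y \<in> carrier S" "y \<noteq> \<zero>"
  shows "integral_over S (fraction S (carrier S - {\<zero>}) x y) \<longleftrightarrow> integral_pair S x y"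
proof -
  interpret F: semidomain_denominators S "carrier S - {\<zero>}"
    by (rule denominatorsI) (simp_all add: submonoid_nonzero)
  let ?F = "localization S (carrier S - {\<zero>})"
  define u where "u = fraction S (carrier S - {\<zero>}) x y"
  have u: "u \<in> carrier ?F" using C by (simp add: u_def F.fraction_closed)
  have yu: "F.embed y \<otimes>\<^bsub>?F\<^esub> u = F.embed x" using C by (simp add: u_def F.embed_mult_fraction)
  have to_fractions: "to_fractions S = F.embed"
    by (simp add: fun_eq_iff to_fractions_def F.embed_def)
  \<comment> \<open>Dehomogenization: the powers of \<open>\<one>\<close> disappear.\<close>
  have form: "(\<Oplus>\<^bsub>?F\<^esub>i\<in>{1..n}. to_fractions S (a i) \<otimes>\<^bsub>?F\<^esub> u [^]\<^bsub>?F\<^esub> (n - i)) =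
      homogeneous_form ?F n (F.embed \<circ> a) u \<one>\<^bsub>?F\<^esub>" if "a \<in> {1..n} \<rightarrow> carrier S" for n :: nat and a
    unfolding homogeneous_form_def to_fractions
    by (rule F.embed.L.finsum_cong) (use that u in \<open>auto simp: Pi_iff simp_implies_def\<close>)
  have "integral_eq ?F n (F.embed \<circ> a) (F.embed \<circ> b) u \<one>\<^bsub>?F\<^esub> \<longleftrightarrow> integral_eq S n a b x y"
    if ab: "a \<in> {1..n} \<rightarrow> carrier S" "b \<in> {1..n} \<rightarrow> carrier S" for n :: nat and a b
  proof -
    have "F.embed \<circ> a \<in> {1..n} \<rightarrow> carrier ?F" "F.embed \<circ> b \<in> {1..n} \<rightarrow> carrier ?F"
      using ab by (simp_all add: Pi_iff)
    then have "integral_eq ?F n (F.embed \<circ> a) (F.embed \<circ> b) u \<one>\<^bsub>?F\<^esub> \<longleftrightarrow>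
        integral_eq ?F n (F.embed \<circ> a) (F.embed \<circ> b) (F.embed y \<otimes>\<^bsub>?F\<^esub> u) (F.embed y \<otimes>\<^bsub>?F\<^esub> \<one>\<^bsub>?F\<^esub>)"
      using C u F.embed_nonzero[of y]
      by (intro F.embed.L.integral_eq_scale_iff[symmetric]) auto
    then show ?thesis
      using C ab by (simp add: yu F.embed.integral_eq_hom_iff)
  qed
  then show ?thesis
    unfolding integral_over_def integral_pair_def semifield_of_fractions_def Let_def u_def[symmetric]
    by (intro ex_cong1 conj_cong refl bex_cong) (simp add: form integral_eq_def del: One_nat_def)
qed

text \<open>Every element of the semifield of fractions is some \<open>x/y\<close> with
  \<open>y\<close> nonzero, and \<open>x/y = s/1\<close> means \<open>x = s \<otimes> y\<close>.
  Applied to a localization, this avoids fractions of fractions.\<close>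

theorem integrally_closed_iff:
  "integrally_closed_semidomain S \<longleftrightarrow>
     (\<forall>x\<in>carrier S. \<forall>y\<in>carrier S. y \<noteq> \<zero> \<longrightarrow> integral_pair S x y \<longrightarrow>
        (\<exists>s\<in>carrier S. x = s \<otimes> y))"
proof -
  interpret F: semidomain_denominators S "carrier S - {\<zero>}"
    by (rule denominatorsI) (simp_all add: submonoid_nonzero)
  have image_iff: "fraction S (carrier S - {\<zero>}) x y \<in> to_fractions S ` carrier S \<longleftrightarrow>
      (\<exists>s\<in>carrier S. x = s \<otimes> y)" if "x \<in> carrier S" "y \<in> carrier S" "y \<noteq> \<zero>" for x y
    using that one_not_zero by (auto simp: image_iff to_fractions_def F.fraction_eq_iff)
  have "integrally_closed_semidomain S \<longleftrightarrow>
      (\<forall>u\<in>carrier (semifield_of_fractions S). integral_over S u \<longrightarrow> u \<in> to_fractions S ` carrier S)"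
    using semidomain_axioms
    by (auto simp: integrally_closed_semidomain_def integrally_closed_semidomain_axioms_def)
  also have "\<dots> \<longleftrightarrow> (\<forall>x\<in>carrier S. \<forall>y\<in>carrier S - {\<zero>}.
      integral_over S (fraction S (carrier S - {\<zero>}) x y) \<longrightarrow>
      fraction S (carrier S - {\<zero>}) x y \<in> to_fractions S ` carrier S)"
    unfolding semifield_of_fractions_def
    by (metis F.fraction_closed F.localization_cases)
  finally show ?thesis
    by (auto simp: integral_over_fraction_iff image_iff)
qed

end

section \<open>Integral closedness of a semidomain and of its localization\<close>

context semidomain_denominators
begin

text \<open>A pair over \<open>L\<close> is scaled into \<open>S\<close>, and its integrality
  descends there at the price of a factor \<open>v\<close> from \<open>T\<close> on the numerator.
  Closedness of \<open>S\<close> gives a quotient \<open>s\<close>, and dividing by \<open>v\<close>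
  again gives the quotient \<open>s/v\<close> in \<open>L\<close>.\<close>

lemma integrally_closed_localization:
  assumes "integrally_closed_semidomain S"
  shows "integrally_closed_semidomain L"
  unfolding embed.L.integrally_closed_iff
proof (intro ballI impI)
  fix X Y assume "X \<in> carrier L" "Y \<in> carrier L" and Y0: "Y \<noteq> \<zero>\<^bsub>L\<^esub>" and P: "integral_pair L X Y"
  then obtain x t y u where C: "x \<in> carrier S" "t \<in> T" "y \<in> carrier S" "u \<in> T"
    and X: "X = fraction S T x t" and Y: "Y = fraction S T y u"
    by (metis localization_cases)
  have y0: "y \<noteq> \<zero>" using Y0 C by (simp add: Y fraction_eq_zero_iff)
  \<comment> \<open>The product of the two denominators brings both \<open>x/t\<close> and
    \<open>y/u\<close> into the image of \<open>S\<close>.\<close>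
  have "embed (t \<otimes> u) \<otimes>\<^bsub>L\<^esub> X = embed (u \<otimes> x)" "embed (t \<otimes> u) \<otimes>\<^bsub>L\<^esub> Y = embed (t \<otimes> y)"
    using C by (simp_all add: X Y embed_def fraction_simps m_ac)
  then have "integral_pair L (embed (u \<otimes> x)) (embed (t \<otimes> y))"
    using P embed.L.integral_pair_scale_iff[of X Y "embed (t \<otimes> u)"] C embed_nonzero
    by (simp add: X Y fraction_closed)
  then obtain v where v: "v \<in> T" "integral_pair S (v \<otimes> (u \<otimes> x)) (t \<otimes> y)"
    using integral_pair_embedD[of "u \<otimes> x" "t \<otimes> y"] C by auto
  moreover have "t \<otimes> y \<noteq> \<zero>" using C y0 zero_notin integral[of t y] by auto
  ultimately obtain s where s: "s \<in> carrier S" "v \<otimes> (u \<otimes> x) = s \<otimes> (t \<otimes> y)"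
    using assms C unfolding integrally_closed_iff by (metis T_carrier m_closed)
  have "x \<otimes> (v \<otimes> u) = v \<otimes> (u \<otimes> x)" using C v by (simp add: m_ac)
  also have "\<dots> = s \<otimes> y \<otimes> t" using C s by (simp add: m_ac)
  finally have "X = fraction S T s v \<otimes>\<^bsub>L\<^esub> Y"
    using C s v by (simp add: X Y fraction_simps)
  then show "\<exists>Z\<in>carrier L. X = Z \<otimes>\<^bsub>L\<^esub> Y"
    using s v fraction_closed by blast
qed

text \<open>Integrality ascends to \<open>L\<close>, where \<open>y\<close> divides \<open>x\<close>
  with some quotient \<open>s/t\<close>; clearing \<open>t\<close> leaves divisibility in
  \<open>S\<close> up to a factor from \<open>T\<close>.\<close>

lemma integrally_closed_localizationD:
  assumes "integrally_closed_semidomain L" "integral_pair S x y"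
    and C: "x \<in> carrier S" "y \<in> carrier S" "y \<noteq> \<zero>"
  obtains s t where "s \<in> carrier S" "t \<in> T" "t \<otimes> x = s \<otimes> y"
proof -
  have "integral_pair L (embed x) (embed y)" "embed y \<noteq> \<zero>\<^bsub>L\<^esub>"
    using assms by (simp_all add: embed.integral_pair_hom embed.hom_eq_zero_iff)
  then obtain Z where "Z \<in> carrier L" "embed x = Z \<otimes>\<^bsub>L\<^esub> embed y"
    using assms(1) C unfolding embed.L.integrally_closed_iff by (meson embed.hom_closed)
  then obtain s t where st: "s \<in> carrier S" "t \<in> T" "embed x = fraction S T s t \<otimes>\<^bsub>L\<^esub> embed y"
    by (metis localization_cases)
  then have "t \<otimes> x = s \<otimes> y"
    using C by (simp add: embed_def fraction_simps m_comm)
  with st show thesis by (intro that)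
qed

end

section \<open>Maximal ideals\<close>

lemma semiring_ideal_zero_mem:
  assumes "semiring_ideal I S"
  shows "\<zero>\<^bsub>S\<^esub> \<in> I"
proof -
  interpret semiring_ideal I S by fact
  obtain a where "a \<in> I" using ideal_nonempty by blast
  then have "\<zero>\<^bsub>S\<^esub> \<otimes>\<^bsub>S\<^esub> a \<in> I" by (simp add: ideal_mult_closed)
  then show ?thesis using \<open>a \<in> I\<close> ideal_subset by auto
qed

lemma semiring_ideal_eq_carrier_iff:
  assumes "semiring_ideal I S"
  shows "I = carrier S \<longleftrightarrow> \<one>\<^bsub>S\<^esub> \<in> I"
proof -
  interpret semiring_ideal I S by fact
  show ?thesis
    using ideal_subset ideal_mult_closed[of "\<one>\<^bsub>S\<^esub>"] by (metis one_closed r_one subsetI subset_antisym)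
qed

text \<open>Zorn's lemma, with properness expressed as \<open>\<one> \<notin> J\<close>, a condition
  that passes to unions of chains.\<close>

lemma exists_maximal_semiring_ideal:
  fixes S (structure)
  assumes I: "semiring_ideal I S" "\<one> \<notin> I"
  obtains M where "maximal_semiring_ideal M S" "I \<subseteq> M"
proof -
  interpret semiring S using I(1) by (rule semiring_ideal.axioms)
  define A where "A = {J. semiring_ideal J S \<and> I \<subseteq> J \<and> \<one> \<notin> J}"
  have "\<exists>M\<in>A. \<forall>J\<in>A. M \<subseteq> J \<longrightarrow> J = M"
  proof (rule subset_Zorn_nonempty)
    show "A \<noteq> {}" using I by (auto simp: A_def)
    fix \<C> assume "\<C> \<noteq> {}" and chain: "subset.chain A \<C>"
    then have J: "semiring_ideal J S" "I \<subseteq> J" "\<one> \<notin> J" if "J \<in> \<C>" for J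
      using that by (auto simp: A_def subset_chain_def)
    have "semiring_ideal (\<Union>\<C>) S"
    proof unfold_locales
      show "\<Union>\<C> \<subseteq> carrier S" using J(1) semiring_ideal.ideal_subset by blast
      show "\<Union>\<C> \<noteq> {}" using J(1) \<open>\<C> \<noteq> {}\<close> semiring_ideal_zero_mem by blast
    next
      fix a b assume "a \<in> \<Union>\<C>" "b \<in> \<Union>\<C>"
      then obtain J K where "J \<in> \<C>" "a \<in> J" "K \<in> \<C>" "b \<in> K" by blast
      moreover from this have "J \<subseteq> K \<or> K \<subseteq> J" using chain by (simp add: subset_chain_def)
      ultimately obtain J where *: "J \<in> \<C>" "a \<in> J" "b \<in> J" by blast
      then have "a \<oplus> b \<in> J" by (intro semiring_ideal.ideal_add_closed[OF J(1)])
      with * show "a \<oplus> b \<in> \<Union>\<C>" by blast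
    next
      fix a s assume "a \<in> \<Union>\<C>" and s: "s \<in> carrier S"
      then obtain J where *: "J \<in> \<C>" "a \<in> J" by blast
      then have "s \<otimes> a \<in> J" using s by (intro semiring_ideal.ideal_mult_closed[OF J(1)])
      with * show "s \<otimes> a \<in> \<Union>\<C>" by blast
    qed
    moreover have "I \<subseteq> \<Union>\<C>" using J(2) \<open>\<C> \<noteq> {}\<close> by fast
    moreover have "\<one> \<notin> \<Union>\<C>" using J(3) by blast
    ultimately show "\<Union>\<C> \<in> A" by (simp add: A_def)
  qed
  then obtain M where M: "semiring_ideal M S" "I \<subseteq> M" "\<one> \<notin> M"
    and max: "\<And>J. J \<in> A \<Longrightarrow> M \<subseteq> J \<Longrightarrow> J = M"
    by (auto simp: A_def)
  have "maximal_semiring_ideal M S"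
  proof (intro maximal_semiring_ideal.intro maximal_semiring_ideal_axioms.intro)
    show "M \<noteq> carrier S" using M by auto
    fix J assume "semiring_ideal J S" "M \<subseteq> J" "J \<noteq> carrier S"
    \<comment> \<open>Being proper and containing \<open>I\<close> through \<open>M\<close>, the
      ideal \<open>J\<close> belongs to \<open>A\<close>, in which \<open>M\<close> is
      maximal.\<close>
    then show "J = M" using M semiring_ideal_eq_carrier_iff by (intro max) (auto simp: A_def)
  qed (rule M)
  with M show thesis by (intro that)
qed

text \<open>Maximal ideals are prime, by an argument free of subtraction: for \<open>a\<close>
  outside \<open>M\<close> the ideal \<open>M + S a\<close> contains 1, and multiplying
  \<open>1 = p + s a\<close> by \<open>b\<close> shows that \<open>a b\<close> in \<open>M\<close>
  would force \<open>b\<close> into \<open>M\<close>.\<close>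

lemma (in semidomain) submonoid_maximal_ideal_complement:
  assumes "maximal_semiring_ideal M S"
  shows "submonoid (carrier S - M) S"
proof
  interpret M: maximal_semiring_ideal M S by fact
  have M: "semiring_ideal M S" by unfold_locales
  have one: "\<one> \<notin> M" using M.ideal_proper semiring_ideal_eq_carrier_iff[OF M] by simp
  show "carrier S - M \<subseteq> carrier S" by blast
  show "\<one> \<in> carrier S - M" using one by simp
  fix a b assume a: "a \<in> carrier S - M" and b: "b \<in> carrier S - M"
  \<comment> \<open>The ideal generated by \<open>M\<close> and \<open>a\<close>.\<close>
  define J where "J = {p \<oplus> s \<otimes> a | p s. p \<in> M \<and> s \<in> carrier S}"
  have JI: "p \<oplus> s \<otimes> a \<in> J" if "p \<in> M" "s \<in> carrier S" for p s
    using that by (auto simp: J_def)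
  have carrier: "p \<in> carrier S" if "p \<in> M" for p using that M.ideal_subset by blast
  have "semiring_ideal J S"
  proof unfold_locales
    show "J \<subseteq> carrier S" using a carrier by (auto simp: J_def)
    show "J \<noteq> {}" using JI M.ideal_nonempty by blast
  next
    fix x y assume "x \<in> J" "y \<in> J"
    then obtain p s q r where *: "p \<in> M" "s \<in> carrier S" "q \<in> M" "r \<in> carrier S"
      "x = p \<oplus> s \<otimes> a" "y = q \<oplus> r \<otimes> a"
      by (auto simp: J_def)
    then have "x \<oplus> y = (p \<oplus> q) \<oplus> (s \<oplus> r) \<otimes> a"
      using a carrier by (simp add: l_distr a_ac)
    then show "x \<oplus> y \<in> J" using * by (simp add: JI M.ideal_add_closed)
  next
    fix x r assume "x \<in> J" and r: "r \<in> carrier S"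
    then obtain p s where *: "p \<in> M" "s \<in> carrier S" "x = p \<oplus> s \<otimes> a"
      by (auto simp: J_def)
    then have "r \<otimes> x = r \<otimes> p \<oplus> (r \<otimes> s) \<otimes> a"
      using a r carrier by (simp add: r_distr m_assoc)
    then show "r \<otimes> x \<in> J" using * r by (simp add: JI M.ideal_mult_closed)
  qed
  moreover have "M \<subseteq> J"
  proof
    fix p assume "p \<in> M"
    then show "p \<in> J" using JI[of p \<zero>] a carrier by simp
  qed
  moreover have "a \<in> J" using JI[of \<zero> \<one>] a semiring_ideal_zero_mem[OF M] by simp
  \<comment> \<open>Otherwise maximality would give \<open>J = M\<close>, but \<open>a\<close> lies
    in \<open>J\<close> and not in \<open>M\<close>.\<close>
  ultimately have "J = carrier S" using M.ideal_maximal a by blast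
  then have "\<one> \<in> J" by simp
  then obtain p s where p: "p \<in> M" "s \<in> carrier S" "\<one> = p \<oplus> s \<otimes> a"
    by (auto simp: J_def)
  have "b = b \<otimes> (p \<oplus> s \<otimes> a)" using b p(3) by (metis DiffD1 r_one)
  also have "\<dots> = b \<otimes> p \<oplus> s \<otimes> (a \<otimes> b)" using a b p carrier by (simp add: r_distr m_ac)
  finally have b_eq: "b = b \<otimes> p \<oplus> s \<otimes> (a \<otimes> b)" .
  have "a \<otimes> b \<notin> M"
  proof
    assume "a \<otimes> b \<in> M"
    then have "b \<otimes> p \<oplus> s \<otimes> (a \<otimes> b) \<in> M"
      using b p by (simp add: M.ideal_add_closed M.ideal_mult_closed)
    then show False using b b_eq by simp
  qed
  then show "a \<otimes> b \<in> carrier S - M" using a b by simp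
qed

text \<open>Each maximal ideal misses some element of the ideal of denominators of
  \<open>x/y\<close>, which therefore is not proper and contains 1.\<close>

lemma (in semidomain) dvd_if_locally_dvd:
  assumes C: "x \<in> carrier S" "y \<in> carrier S"
    and local: "\<And>M. maximal_semiring_ideal M S \<Longrightarrow>
      \<exists>t\<in>carrier S - M. \<exists>s\<in>carrier S. t \<otimes> x = s \<otimes> y"
  shows "\<exists>s\<in>carrier S. x = s \<otimes> y"
proof -
  define I where "I = {t \<in> carrier S. \<exists>s\<in>carrier S. t \<otimes> x = s \<otimes> y}"
  have "semiring_ideal I S"
  proof unfold_locales
    show "I \<subseteq> carrier S" by (auto simp: I_def)
    \<comment> \<open>\<open>y\<close> is itself a denominator, since
      \<open>y \<otimes> x = x \<otimes> y\<close>.\<close>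
    show "I \<noteq> {}" using C m_comm by (auto simp: I_def)
  next
    fix t u assume "t \<in> I" "u \<in> I"
    then obtain r s where "t \<in> carrier S" "u \<in> carrier S" "r \<in> carrier S" "s \<in> carrier S"
      "t \<otimes> x = r \<otimes> y" "u \<otimes> x = s \<otimes> y"
      by (auto simp: I_def)
    then have "(t \<oplus> u) \<otimes> x = (r \<oplus> s) \<otimes> y" using C by (simp add: l_distr)
    then show "t \<oplus> u \<in> I"
      using \<open>t \<in> carrier S\<close> \<open>u \<in> carrier S\<close> \<open>r \<in> carrier S\<close> \<open>s \<in> carrier S\<close> by (auto simp: I_def)
  next
    fix t r assume "t \<in> I" and r: "r \<in> carrier S"
    then obtain s where "t \<in> carrier S" "s \<in> carrier S" "t \<otimes> x = s \<otimes> y"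
      by (auto simp: I_def)
    then have "(r \<otimes> t) \<otimes> x = (r \<otimes> s) \<otimes> y" using C r by (simp add: m_assoc)
    then show "r \<otimes> t \<in> I"
      using r \<open>t \<in> carrier S\<close> \<open>s \<in> carrier S\<close> by (auto simp: I_def)
  qed
  moreover have False if "maximal_semiring_ideal M S" "I \<subseteq> M" for M
    using local[OF that(1)] that(2) by (auto simp: I_def)
  ultimately have "\<one> \<in> I" using exists_maximal_semiring_ideal by metis
  then show ?thesis using C by (auto simp: I_def)
qed

text \<open>The implications are proved in the cycle (1) to (2) to (3) to (1). The sets
  \<open>T\<close> avoid 0 because otherwise the localization would not be a semidomain.\<close>

theorem theorem5p2:
  fixes S (structure)
  assumes "semidomain S"
  shows "(integrally_closed_semidomain S \<longleftrightarrow>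
            (\<forall>T. submonoid T S \<and> \<zero> \<notin> T \<longrightarrow> integrally_closed_semidomain (localization S T))) \<and>
         (integrally_closed_semidomain S \<longleftrightarrow>
            (\<forall>\<mm>. maximal_semiring_ideal \<mm> S \<longrightarrow>
                    integrally_closed_semidomain (localization S (carrier S - \<mm>))))"
proof -
  interpret semidomain S by fact
  let ?all = "\<forall>T. submonoid T S \<and> \<zero> \<notin> T \<longrightarrow> integrally_closed_semidomain (localization S T)"
  let ?max = "\<forall>\<mm>. maximal_semiring_ideal \<mm> S \<longrightarrow>
                    integrally_closed_semidomain (localization S (carrier S - \<mm>))"
  \<comment> \<open>Complements of maximal ideals are among the sets \<open>T\<close> of (2), which
    gives (3) from (2).\<close>
  have complement: "submonoid (carrier S - \<mm>) S" "\<zero> \<notin> carrier S - \<mm>"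
    if "maximal_semiring_ideal \<mm> S" for \<mm>
    using semiring_ideal_zero_mem[OF maximal_semiring_ideal.axioms(1)[OF that]]
      submonoid_maximal_ideal_complement[OF that] by simp_all
  have "?all" if "integrally_closed_semidomain S"
    using semidomain_denominators.integrally_closed_localization[OF denominatorsI that] by simp
  moreover have "?max" if "?all"
    using that complement by simp
  moreover have "integrally_closed_semidomain S" if "?max"
    unfolding integrally_closed_iff
  proof (intro ballI impI)
    fix x y assume C: "x \<in> carrier S" "y \<in> carrier S" "y \<noteq> \<zero>" and P: "integral_pair S x y"
    show "\<exists>s\<in>carrier S. x = s \<otimes> y"
    proof (rule dvd_if_locally_dvd[OF C(1,2)])
      fix \<mm> assume \<mm>: "maximal_semiring_ideal \<mm> S"
      interpret semidomain_denominators S "carrier S - \<mm>"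
        by (rule denominatorsI) (rule complement[OF \<mm>])+
      \<comment> \<open>Closedness at \<open>\<mm>\<close> provides a denominator of
        \<open>x/y\<close> outside \<open>\<mm>\<close>.\<close>
      show "\<exists>t\<in>carrier S - \<mm>. \<exists>s\<in>carrier S. t \<otimes> x = s \<otimes> y"
        using integrally_closed_localizationD[OF _ P C] that \<mm> by blast
    qed
  qed
  ultimately show ?thesis by blast
qed

end
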